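(* Let $m\ge 4$ and $3\le t\le m$ be integers. Then for all integers $n\ge \frac{t(t-1)}{2}+m-t$, \[RS_{t,m}(n)=\left\lceil \frac{(t-3)n+\frac{t(t-1)}{2}+m-t}{t-2}\right\rceil.\]
   Context: For $m\ge 3$, $E_m$ denotes the equation $x_1+x_2+\cdots+x_{m-1}=x_m$. For a positive integer $n$, $[1,n]=\{1,2,\ldots,n\}$. An $r$-coloring of a set $S$ is a map $S\to\{1,\ldots,r\}$; it is exact if it is surjective. A solution to $E_m$ in $[1,n]$ is a tuple $(x_1,\ldots,x_m)$ of (not necessarily distinct) elements of $[1,n]$ satisfying $E_m$. For $m\ge 3$ and $2\le t\le m$, the weakened rainbow Schur number $RS_{t,m}(n)$ is the minimum positive integer $r$ such that every exact $r$-coloring of $[1,n]$ admits a solution $(x_1,\ldots,x_m)$ to $E_m$ in $[1,n]$ whose entries $x_1,\ldots,x_m$ receive at least $t$ distinct colors. *)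

theory Defs
  imports Complex_Main
begin

definition exact_coloring :: "nat \<Rightarrow> nat \<Rightarrow> (nat \<Rightarrow> nat) \<Rightarrow> bool" where
  "exact_coloring r n c \<longleftrightarrow> c ` {1..n} = {1..r}"

(* The tuple (x_1, ..., x_m) is the restriction of x to {1..m}; other values of x are irrelevant. *)
definition schur_solution :: "nat \<Rightarrow> nat \<Rightarrow> (nat \<Rightarrow> nat) \<Rightarrow> bool" where
  "schur_solution m n x \<longleftrightarrow>
     (\<forall>i\<in>{1..m}. x i \<in> {1..n}) \<and> (\<Sum>i=1..m-1. x i) = x m"

definition forces_solution :: "nat \<Rightarrow> nat \<Rightarrow> nat \<Rightarrow> nat \<Rightarrow> bool" where
  "forces_solution t m n r \<longleftrightarrow>
     (\<forall>c. exact_coloring r n c \<longrightarrow>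
        (\<exists>x. schur_solution m n x \<and> card (c ` x ` {1..m}) \<ge> t))"

definition RS :: "nat \<Rightarrow> nat \<Rightarrow> nat \<Rightarrow> nat" where
  "RS t m n = (LEAST r. r \<ge> 1 \<and> forces_solution t m n r)"

(* The minimum is always attained: there is no exact (n+1)-coloring of {1..n}. *)
lemma forces_solution_Suc: "forces_solution t m n (Suc n)"
proof -
  have "\<not> exact_coloring (Suc n) n c" for c
  proof
    assume "exact_coloring (Suc n) n c"
    then have "card (c ` {1..n}) = Suc n"
      by (simp add: exact_coloring_def)
    moreover have "card (c ` {1..n}) \<le> n"
      using card_image_le[of "{1..n}" c] by simp
    ultimately show False by simp
  qed
  then show ?thesis by (simp add: forces_solution_def)
qed

lemma RS_attained: "RS t m n \<ge> 1 \<and> forces_solution t m n (RS t m n)"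
  unfolding RS_def by (rule LeastI[of _ "Suc n"]) (simp add: forces_solution_Suc)

end

theory Submission
  imports Defs
begin

text \<open>
  Put \<open>N = t (t - 1) / 2 + m - t\<close> and let \<open>k\<close> be the integer part of \<open>(n - N) / (t - 2)\<close>; the
  claimed value is \<open>n - k\<close>.

  Lower bound: with at most \<open>n - k - 1\<close> colors, give \<open>1, \<dots>, j\<close> one color, where \<open>j \<ge> k + 2\<close>,
  and every larger number a color of its own. A solution with \<open>t\<close> colors has at least \<open>t - 2\<close>
  distinct summands above \<open>j\<close>, which makes its sum exceed \<open>n\<close>.

  Upper bound: by induction on \<open>n\<close> we may assume that the color of \<open>n\<close> is unique, since
  otherwise deleting \<open>n\<close> lowers both \<open>n\<close> and \<open>k\<close> by one. It then suffices to write \<open>n\<close> as a sum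
  using \<open>t - 1\<close> colors. For \<open>t \<ge> 4\<close> choose greedily \<open>t - 3\<close> small numbers of distinct colors.
  The remaining two summands \<open>y < z\<close> have a prescribed sum \<open>Q\<close>; if every such pair failed, each
  of these disjoint pairs would contain a number whose color also occurs elsewhere, and the
  coloring would have fewer than \<open>n - k\<close> colors. For \<open>t = 3\<close> use the summands
  \<open>1, \<dots>, 1, y, z\<close> with \<open>y\<close> not of the color of \<open>1\<close>.
\<close>

section \<open>Lower bound: a coloring with one large class\<close>

lemma sum_ge_of_lower_bound:
  fixes V :: "nat set"
  assumes "finite V" and "\<And>v. v \<in> V \<Longrightarrow> a \<le> v"
  shows "2 * card V * a + card V * (card V - 1) \<le> 2 * \<Sum>V"
  using assms
proof (induction V rule: finite_linorder_max_induct)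
  case empty
  then show ?case by simp
next
  case (insert b V)
  have "V \<subseteq> {a..<b}" using insert by force
  then have "card V \<le> b - a" using card_mono[of "{a..<b}" V] by simp
  moreover have "a \<le> b" using insert.prems by simp
  ultimately have b: "a + card V \<le> b" by simp
  have V: "2 * card V * a + card V * (card V - 1) \<le> 2 * \<Sum>V"
    using insert by simp
  have "b \<notin> V" using insert.hyps by blast
  then have "card (insert b V) = Suc (card V)" "\<Sum>(insert b V) = b + \<Sum>V"
    using insert.hyps by auto
  moreover have "Suc q * q = 2 * q + q * (q - 1)" for q :: nat
    by (cases q) auto
  ultimately show ?case using V b by (simp add: algebra_simps)
qed

text \<open>The entry \<open>x m\<close> and the color \<open>a\<close> account for at most two
  colors, so \<open>t - 2\<close> distinct summands exceed \<open>j\<close>. Measured against the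
  all-ones sum \<open>m - 1\<close>, their excesses \<open>x i - 1\<close> are distinct and at least
  \<open>j\<close>.\<close>

lemma sum_bound_if_many_colors:
  assumes t: "3 \<le> t" "t \<le> m"
    and x: "schur_solution m n x" and colors: "t \<le> card (c ` x ` {1..m})"
    and c: "\<And>v. 1 \<le> v \<Longrightarrow> v \<le> j \<Longrightarrow> c v = a"
  shows "(m - 1) + (t - 2) * j + (t - 2) * (t - 3) div 2 \<le> n"
proof -
  define X where "X = x ` {1..m-1}"
  define V where "V = {v \<in> X. j < v}"
  have pos: "1 \<le> x i" "x i \<le> n" if "i \<in> {1..m}" for i
    using x that by (auto simp: schur_solution_def)
  have fin: "finite X" "finite V" by (auto simp: X_def V_def)
  have "{1..m} = insert m {1..m-1}" using t by auto
  then have "c ` x ` {1..m} = insert (c (x m)) (c ` X)" by (simp add: X_def)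
  then have "t \<le> Suc (card (c ` X))"
    using colors card_insert_le_m1[of "Suc (card (c ` X))" "c ` X" "c (x m)"] by simp
  moreover have "c ` X \<subseteq> insert a (c ` V)"
    using pos by (fastforce simp: X_def V_def intro: c)
  then have "card (c ` X) \<le> card (insert a (c ` V))" using fin by (intro card_mono) auto
  then have "card (c ` X) \<le> Suc (card (c ` V))"
    using card_insert_le_m1[of "Suc (card (c ` V))" "c ` V" a] by simp
  ultimately have "t - 2 \<le> card (c ` V)" by simp
  also have "\<dots> \<le> card V" using fin card_image_le by blast
  finally obtain W where W: "W \<subseteq> V" "card W = t - 2"
    by (meson obtain_subset_with_card_n)
  have finW: "finite W" using W fin finite_subset by blast
  have inj: "inj_on (\<lambda>v. v - 1) W"
  proof (rule inj_onI)
    fix v w assume "v \<in> W" "w \<in> W" "v - 1 = w - 1"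
    moreover have "j < v" "j < w" using W \<open>v \<in> W\<close> \<open>w \<in> W\<close> by (auto simp: V_def)
    ultimately show "v = w" by simp
  qed
  have "2 * (t - 2) * j + (t - 2) * (t - 3) \<le> 2 * (\<Sum>v\<in>W. v - 1)"
  proof -
    have card: "card ((\<lambda>v. v - 1) ` W) = t - 2" using inj W by (simp add: card_image)
    have "2 * card ((\<lambda>v. v - 1) ` W) * j + card ((\<lambda>v. v - 1) ` W) * (card ((\<lambda>v. v - 1) ` W) - 1)
        \<le> 2 * \<Sum>((\<lambda>v. v - 1) ` W)"
      using finW W by (intro sum_ge_of_lower_bound) (auto simp: V_def)
    moreover have "\<Sum>((\<lambda>v. v - 1) ` W) = (\<Sum>v\<in>W. v - 1)" using inj by (simp add: sum.reindex)
    moreover have "t - 2 - 1 = t - 3" by simp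
    ultimately show ?thesis unfolding card by simp
  qed
  then have "(t - 2) * j + (t - 2) * (t - 3) div 2 \<le> (\<Sum>v\<in>W. v - 1)" by linarith
  also have "\<dots> \<le> (\<Sum>v\<in>X. v - 1)"
    using W fin by (intro sum_mono2) (auto simp: V_def)
  \<comment> \<open>Only an inequality, since a value repeated in the tuple counts once in
    \<open>X\<close>.\<close>
  also have "\<dots> \<le> (\<Sum>i=1..m-1. x i - 1)"
    using sum_image_le[of "{1..m-1}" "\<lambda>v. v - 1" x] by (simp add: X_def o_def)
  finally have le: "(t - 2) * j + (t - 2) * (t - 3) div 2 \<le> (\<Sum>i=1..m-1. x i - 1)" .
  have "(\<Sum>i=1..m-1. x i) = (\<Sum>i=1..m-1. (x i - 1) + 1)"
  proof (rule sum.cong)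
    show "x i = x i - 1 + 1" if "i \<in> {1..m-1}" for i using pos(1)[of i] that by fastforce
  qed simp
  also have "\<dots> = (\<Sum>i=1..m-1. x i - 1) + (m - 1)" by (subst sum.distrib) simp
  finally have "x m = (\<Sum>i=1..m-1. x i - 1) + (m - 1)"
    using x by (simp add: schur_solution_def)
  moreover have "x m \<le> n" using pos[of m] t by simp
  ultimately show ?thesis using le by linarith
qed

lemma not_forces_solution:
  assumes t: "3 \<le> t" "t \<le> m" and r: "1 \<le> r" "r + k < n"
    and n: "n < t * (t - 1) div 2 + (m - t) + (t - 2) * (k + 1)"
  shows "\<not> forces_solution t m n r"
proof
  assume forces: "forces_solution t m n r"
  \<comment> \<open>This leaves \<open>r - 1\<close> numbers above \<open>j\<close>, one for each
    color other than 1.\<close>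
  define j where "j = n - r + 1"
  define c where "c v = (if v \<le> j then 1 else v - j + 1)" for v
  have j: "k + 2 \<le> j" "j + r = n + 1" using r by (auto simp: j_def)
  have "exact_coloring r n c"
    unfolding exact_coloring_def
  proof (intro equalityI subsetI)
    fix v assume "v \<in> c ` {1..n}"
    then show "v \<in> {1..r}" using j r by (auto simp: c_def)
  next
    fix v assume v: "v \<in> {1..r}"
    then have "c (j + v - 1) = v" "j + v - 1 \<in> {1..n}" using j by (auto simp: c_def)
    then show "v \<in> c ` {1..n}" by (metis imageI)
  qed
  then obtain x where "schur_solution m n x" "t \<le> card (c ` x ` {1..m})"
    using forces by (auto simp: forces_solution_def)
  then have "(m - 1) + (t - 2) * j + (t - 2) * (t - 3) div 2 \<le> n"
    using t by (intro sum_bound_if_many_colors[where c = c and a = 1]) (auto simp: c_def)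
  moreover have "(t - 2) * (k + 2) \<le> (t - 2) * j" using j by (intro mult_le_mono) auto
  moreover obtain p where p: "t = p + 3" using t by (metis add.commute le_Suc_ex)
  \<comment> \<open>By this identity, the bound of \<open>sum_bound_if_many_colors\<close> at
    \<open>j = k + 2\<close> is exactly the strict upper bound assumed for \<open>n\<close>.\<close>
  have "t * (t - 1) = (t - 2) * (t - 3) + 2 * (2 * t - 3)"
    unfolding p by (simp add: algebra_simps)
  then have "t * (t - 1) div 2 = (t - 2) * (t - 3) div 2 + (2 * t - 3)" by simp
  moreover have "(t - 2) * (k + 2) = (t - 2) * (k + 1) + (t - 2)" by simp
  ultimately show False using n t by linarith
qed

section \<open>Upper bound: solutions when at most \<open>k\<close> colors are lost\<close>

lemma schur_solution_of_list:
  assumes "length xs = m - 1" and "1 \<le> m" and "set xs \<subseteq> {1..n}" and "sum_list xs = n" and "1 \<le> n"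
  obtains x where "schur_solution m n x" and "x ` {1..m} = insert n (set xs)"
proof -
  define x where "x i = (if i = m then n else xs ! (i - 1))" for i
  have x: "x ` {1..m-1} = set xs"
  proof -
    have "{1..m-1} = Suc ` {0..<m-1}"
      by (metis atLeastLessThanSuc_atLeastAtMost image_Suc_atLeastLessThan One_nat_def)
    then have "x ` {1..m-1} = (\<lambda>i. x (Suc i)) ` {0..<m-1}" by (simp only: image_image)
    also have "\<dots> = (\<lambda>i. xs ! i) ` {0..<m-1}"
      by (intro image_cong) (auto simp: x_def)
    also have "\<dots> = set xs" using assms(1) by (auto simp: set_conv_nth)
    finally show ?thesis .
  qed
  have m: "{1..m} = insert m {1..m-1}" using assms by auto
  have im: "x ` {1..m} = insert n (set xs)"
    unfolding m image_insert x by (simp add: x_def)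
  have "(\<Sum>i=1..m-1. x i) = (\<Sum>i=1..m-1. xs ! (i - 1))"
    using assms by (intro sum.cong) (auto simp: x_def)
  also have "\<dots> = (\<Sum>i<m-1. xs ! i)"
    by (rule sum.reindex_bij_witness[of _ Suc "\<lambda>i. i - 1"]) auto
  also have "\<dots> = sum_list xs"
    using assms by (simp add: sum_list_sum_nth atLeast0LessThan)
  finally have "(\<Sum>i=1..m-1. x i) = x m" using assms by (simp add: x_def)
  moreover have "x i \<in> {1..n}" if "i \<in> {1..m}" for i
  proof -
    have "x i \<in> insert n (set xs)" using im that by blast
    then show ?thesis using assms(3,5) by auto
  qed
  ultimately have "schur_solution m n x" by (simp add: schur_solution_def)
  then show ?thesis using im that by blast
qed

text \<open>Deleting the numbers above \<open>i\<close> loses at most \<open>n - i\<close> colors,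
  so initial segments inherit the defect bound \<open>k\<close>.\<close>

lemma card_colors_initial:
  assumes "n \<le> card (c ` {1..n}) + k" and "i \<le> n"
  shows "i \<le> card (c ` {1..i}) + k"
proof -
  have "{1..n} = {1..i} \<union> {i<..n}" using assms by auto
  then have "card (c ` {1..n}) \<le> card (c ` {1..i}) + card (c ` {i<..n})"
    by (metis card_Un_le image_Un)
  moreover have "card (c ` {i<..n}) \<le> n - i" using card_image_le[of "{i<..n}" c] by simp
  ultimately show ?thesis using assms by linarith
qed

text \<open>Start with 1. Since \<open>{1..k + i}\<close> carries at least \<open>i\<close> colors,
  the \<open>i\<close>-th choice can be at most \<open>k + i\<close>; summing these bounds for
  \<open>i\<close> from 2 to \<open>j + 1\<close> and adding 1 gives the estimate, stated
  doubled.\<close>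

lemma small_rainbow_set:
  assumes c: "n \<le> card (c ` {1..n}) + k" and "k + Suc j \<le> n"
  shows "\<exists>A. A \<subseteq> {1..n} \<and> card A = Suc j \<and> inj_on c A \<and> 2 * \<Sum>A \<le> Suc j * (j + 2) + 2 * j * k"
  using assms(2)
proof (induction j)
  case 0
  then show ?case by (intro exI[of _ "{1}"]) auto
next
  case (Suc j)
  then obtain A where A: "A \<subseteq> {1..n}" "card A = Suc j" "inj_on c A"
    "2 * \<Sum>A \<le> Suc j * (j + 2) + 2 * j * k" by auto
  have fin: "finite A" using A finite_subset by blast
  have "Suc (Suc j) \<le> card (c ` {1..k + Suc (Suc j)})"
    using card_colors_initial[OF c Suc.prems] by simp
  moreover have "card (c ` A) = Suc j" using A by (simp add: card_image)
  ultimately have "\<not> c ` {1..k + Suc (Suc j)} \<subseteq> c ` A"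
    using fin card_mono[of "c ` A" "c ` {1..k + Suc (Suc j)}"] by auto
  then obtain a where a: "a \<in> {1..k + Suc (Suc j)}" "c a \<notin> c ` A" by blast
  then have "a \<notin> A" by blast
  then have "card (insert a A) = Suc (Suc j)" "\<Sum>(insert a A) = a + \<Sum>A"
    using A fin by auto
  moreover have "2 * (a + \<Sum>A) \<le> Suc (Suc j) * (Suc j + 2) + 2 * Suc j * k"
    using a A by (simp add: algebra_simps)
  moreover have "insert a A \<subseteq> {1..n}" "inj_on c (insert a A)"
    using a A Suc.prems by auto
  ultimately show ?case by metis
qed

text \<open>
  In every failing pair \<open>{y, Q - y}\<close> one member \<open>e y\<close> can be dropped without losing a color, unless
  it lies in \<open>A\<close> itself.
\<close>

lemma rainbow_pair:
  assumes c: "n \<le> card (c ` {1..n}) + k" and A: "A \<subseteq> {1..n}"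
    and Q: "2 * (card A + k) + 3 \<le> Q" "Q \<le> n"
  obtains y z where "1 \<le> y" "1 \<le> z" "y + z = Q" "c y \<noteq> c z" "c y \<notin> c ` A" "c z \<notin> c ` A"
proof (rule ccontr)
  note good = that
  assume neg: "\<not> thesis"
  \<comment> \<open>The number of disjoint pairs \<open>{y, Q - y}\<close> with
    \<open>y < Q - y\<close>.\<close>
  define h where "h = (Q - 1) div 2"
  define e where "e y = (if c y \<in> c ` A then y else Q - y)" for y
  define E where "E = e ` {1..h}"
  have fin: "finite A" using A finite_subset by blast
  have h: "card A + k < h" "2 * h < Q" using Q by (auto simp: h_def)
  have bad: "c y \<in> c ` A \<or> c (Q - y) \<in> c ` A \<or> c y = c (Q - y)" if b: "y \<in> {1..h}" for y
    using neg good[of y "Q - y"] b h by fastforce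
  have "inj_on e {1..h}" using h by (fastforce simp: inj_on_def e_def split: if_splits)
  then have cardE: "card E = h" by (simp add: E_def card_image)
  have E: "E \<subseteq> {1..n}" using h Q by (auto simp: E_def e_def)
  have "c v \<in> c ` ({1..n} - (E - A))" if v: "v \<in> E - A" for v
  proof -
    obtain y where y: "y \<in> {1..h}" "v = e y" using v by (auto simp: E_def)
    show ?thesis
    proof (cases "c v \<in> c ` A")
      case True
      then show ?thesis using A by blast
    next
      case False
      then have cy: "c y \<notin> c ` A" "v = Q - y" using y by (auto simp: e_def split: if_splits)
      then have "c v = c y" using bad[OF y(1)] False by auto
      \<comment> \<open>\<open>e\<close> picks only one member of each pair, here
        \<open>Q - y\<close>, so \<open>y\<close> survives and keeps the color.\<close>
      moreover have "y \<notin> E"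
        using y cy h by (auto simp: E_def e_def split: if_splits)
      moreover have "y \<in> {1..n}" using y h Q by auto
      ultimately show ?thesis by blast
    qed
  qed
  then have "c ` {1..n} \<subseteq> c ` ({1..n} - (E - A))" by blast
  then have "card (c ` {1..n}) \<le> card (c ` ({1..n} - (E - A)))" by (intro card_mono) auto
  also have "\<dots> \<le> card ({1..n} - (E - A))" by (intro card_image_le) auto
  also have "\<dots> = n - card (E - A)"
    using E finite_subset[OF E] by (subst card_Diff_subset) auto
  finally have "card (c ` {1..n}) \<le> n - card (E - A)" .
  moreover have "h - card A \<le> card (E - A)"
    using diff_card_le_card_Diff[OF fin, of E] cardE by simp
  moreover have "h \<le> n" using h Q by linarith
  ultimately show False using c h by linarith
qed

lemma solution_if_unique_top:
  assumes m: "4 \<le> m" and t: "3 \<le> t" "t \<le> m"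
    and n: "t * (t - 1) div 2 + (m - t) + (t - 2) * k \<le> n"
    and c: "n \<le> card (c ` {1..n}) + k"
    and top: "c n \<notin> c ` {1..<n}"
  shows "\<exists>x. schur_solution m n x \<and> t \<le> card (c ` x ` {1..m})"
proof (cases "t = 3")
  case True
  \<comment> \<open>Here \<open>rainbow_pair\<close> with empty \<open>A\<close> would require
    \<open>m + 2 * k \<le> n\<close>. Instead the color of the padding ones is used; as
    \<open>m \<ge> 4\<close>, there is at least one.\<close>
  have mk: "m + k \<le> n" using n m unfolding True by simp
  \<comment> \<open>The range leaves room for \<open>z \<ge> 1\<close> and \<open>m - 3\<close>
    ones. If it were monochromatic, there would be at most \<open>m - 1\<close> colors.\<close>
  have "\<exists>y\<in>{1..n-m+2}. c y \<noteq> c 1"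
  proof (rule ccontr)
    assume neg: "\<not> ?thesis"
    have "c ` {1..n} \<subseteq> insert (c 1) (c ` {n-m+2<..n})"
    proof (rule image_subsetI)
      fix v assume "v \<in> {1..n}"
      then consider "v \<in> {1..n-m+2}" | "v \<in> {n-m+2<..n}" by fastforce
      then show "c v \<in> insert (c 1) (c ` {n-m+2<..n})" using neg by cases blast+
    qed
    then have "card (c ` {1..n}) \<le> card (insert (c 1) (c ` {n-m+2<..n}))"
      by (intro card_mono) auto
    also have "\<dots> \<le> Suc (card (c ` {n-m+2<..n}))" by (simp add: card_insert_if)
    also have "\<dots> \<le> Suc (m - 2)"
      using card_image_le[of "{n-m+2<..n}" c] mk m by simp
    finally show False using c mk m by linarith
  qed
  then obtain y where y: "y \<in> {1..n-m+2}" "c y \<noteq> c 1" by blast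
  define z where "z = n - m + 3 - y"
  define xs where "xs = y # z # replicate (m - 3) 1"
  have z: "1 \<le> z" "y + z + (m - 3) = n" using y mk m by (auto simp: z_def)
  have xs: "length xs = m - 1" "1 \<le> m" "set xs \<subseteq> {1..n}" "sum_list xs = n" "1 \<le> n"
    using y z m by (auto simp: xs_def sum_list_replicate)
  obtain x where x: "schur_solution m n x" "x ` {1..m} = insert n (set xs)"
    using schur_solution_of_list[OF xs] by blast
  have "{c n, c y, c 1} \<subseteq> c ` x ` {1..m}"
    unfolding x(2) using m by (auto simp: xs_def)
  then have "card {c n, c y, c 1} \<le> card (c ` x ` {1..m})" by (intro card_mono) auto
  moreover have "c n \<noteq> c y" "c n \<noteq> c 1"
    using top y z m by (auto simp: image_iff)
  ultimately have "3 \<le> card (c ` x ` {1..m})" using y by simp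
  then show ?thesis using x True by blast
next
  case False
  obtain p where p: "t = p + 4" using t False le_Suc_ex[of 4 t] by (auto simp: add.commute)
  have "even (t * (t - 1))" by (cases t) auto
  then have "2 * (t * (t - 1) div 2) = t * (t - 1)" by simp
  then have D: "2 * (t * (t - 1) div 2) = p * p + 7 * p + 12"
    unfolding p by (simp add: algebra_simps)
  have n': "p * p + 7 * p + 12 + 2 * (m - t) + 2 * (p * k) + 4 * k \<le> 2 * n"
  proof -
    have "2 * ((t - 2) * k) = 2 * (p * k) + 4 * k" by (simp add: p algebra_simps)
    then show ?thesis using n D by linarith
  qed
  have "k + Suc p \<le> n" using n' by linarith
  then obtain A where A: "A \<subseteq> {1..n}" "card A = Suc p" "inj_on c A"
    "2 * \<Sum>A \<le> Suc p * (p + 2) + 2 * p * k"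
    using small_rainbow_set[OF c] by blast
  have fin: "finite A" using A finite_subset by blast
  have A4: "2 * \<Sum>A \<le> p * p + 3 * p + 2 + 2 * (p * k)" using A(4) by (simp add: algebra_simps)
  define Q where "Q = n - (m - t) - \<Sum>A"
  \<comment> \<open>Tight: the doubled requirement on \<open>Q\<close>, the padding and the greedy
    bound \<open>A4\<close> add up to exactly the left side of \<open>n'\<close>.\<close>
  have "2 * (card A + k) + 3 + (m - t) + \<Sum>A \<le> n"
    unfolding A(2) using n' A4 by simp
  then have Q: "2 * (card A + k) + 3 \<le> Q" "Q + (m - t) + \<Sum>A = n"
    unfolding Q_def by simp_all
  then have "Q \<le> n" by linarith
  then obtain y z where yz: "1 \<le> y" "1 \<le> z" "y + z = Q" "c y \<noteq> c z" "c y \<notin> c ` A" "c z \<notin> c ` A"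
    using rainbow_pair[OF c A(1) Q(1)] by blast
  define B where "B = insert y (insert z A)"
  have new: "y \<notin> insert z A" "z \<notin> A" using yz by auto
  have B: "finite B" "card B = t - 1" "\<Sum>B + (m - t) = n" "inj_on c B"
    using fin new A Q yz by (auto simp: B_def p)
  \<comment> \<open>All summands lie below \<open>n\<close>, so \<open>top\<close> makes
    \<open>c n\<close> the missing \<open>t\<close>-th color.\<close>
  have Bn: "B \<subseteq> {1..<n}"
  proof
    fix b assume b: "b \<in> B"
    have "v < \<Sum>B" if "v \<in> B" for v
    proof -
      have "\<Sum>B = v + \<Sum>(B - {v})" using B(1) that by (rule sum.remove)
      moreover have "B - {v} \<noteq> {}" using yz by (auto simp: B_def)
      then have "0 < \<Sum>(B - {v})" using B(1) A yz by (intro sum_pos) (auto simp: B_def)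
      ultimately show ?thesis by simp
    qed
    then have "b < n" using b B(3) by (metis trans_less_add1)
    moreover have "1 \<le> b" using b A yz by (auto simp: B_def)
    ultimately show "b \<in> {1..<n}" by simp
  qed
  define xs where "xs = sorted_list_of_set B @ replicate (m - t) 1"
  have "sum_list (sorted_list_of_set B) = \<Sum>B"
    using B(1) by (simp add: sum_list_distinct_conv_sum_set[of _ "\<lambda>v. v", simplified])
  then have xs: "length xs = m - 1" "1 \<le> m" "set xs \<subseteq> {1..n}" "sum_list xs = n" "1 \<le> n"
    using B Bn t m Q yz by (auto simp: xs_def sum_list_replicate)
  obtain x where x: "schur_solution m n x" "x ` {1..m} = insert n (set xs)"
    using schur_solution_of_list[OF xs] by blast
  have "insert (c n) (c ` B) \<subseteq> c ` x ` {1..m}"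
    unfolding x(2) using B(1) by (auto simp: xs_def)
  then have "card (insert (c n) (c ` B)) \<le> card (c ` x ` {1..m})" by (intro card_mono) auto
  moreover have "c n \<notin> c ` B" using top Bn by blast
  then have "card (insert (c n) (c ` B)) = t" using B t by (simp add: card_image)
  ultimately show ?thesis using x by auto
qed

lemma solution_if_many_colors:
  assumes m: "4 \<le> m" and t: "3 \<le> t" "t \<le> m"
    and "t * (t - 1) div 2 + (m - t) + (t - 2) * k \<le> n"
    and "n \<le> card (c ` {1..n}) + k"
  shows "\<exists>x. schur_solution m n x \<and> t \<le> card (c ` x ` {1..m})"
  using assms(4,5)
proof (induction n arbitrary: k)
  case 0
  have "3 * 2 \<le> t * (t - 1)" using t by (intro mult_le_mono) auto
  then show ?case using 0 by linarith
next
  case (Suc n)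
  show ?case
  proof (cases "c (Suc n) \<in> c ` {1..n}")
    case False
    then have "c (Suc n) \<notin> c ` {1..<Suc n}" unfolding atLeastLessThanSuc_atLeastAtMost .
    then show ?thesis by (rule solution_if_unique_top[OF m t Suc.prems])
  next
    case True
    then have eq: "c ` {1..Suc n} = c ` {1..n}" by (auto simp: atLeastAtMostSuc_conv)
    then have le: "Suc n \<le> card (c ` {1..n}) + k" using Suc.prems by simp
    moreover have "card (c ` {1..n}) \<le> n" using card_image_le[of "{1..n}" c] by simp
    ultimately obtain k' where k: "k = Suc k'" by (cases k) auto
    \<comment> \<open>The threshold drops by \<open>t - 2 \<ge> 1\<close>, which pays for deleting
      the top number.\<close>
    have "t * (t - 1) div 2 + (m - t) + (t - 2) * k' \<le> n"
      using Suc.prems(1) t by (simp add: k)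
    moreover have "n \<le> card (c ` {1..n}) + k'" using le k by simp
    ultimately obtain x where x: "schur_solution m n x" "t \<le> card (c ` x ` {1..m})"
      using Suc.IH by blast
    then have "schur_solution m (Suc n) x" by (auto simp: schur_solution_def)
    then show ?thesis using x by blast
  qed
qed

section \<open>The exact value and its ceiling form\<close>

lemma RS_eq:
  assumes m: "4 \<le> m" and t: "3 \<le> t" "t \<le> m"
    and n: "t * (t - 1) div 2 + (m - t) + (t - 2) * k \<le> n"
      "n < t * (t - 1) div 2 + (m - t) + (t - 2) * (k + 1)"
  shows "RS t m n + k = n"
proof -
  have "3 * 2 \<le> t * (t - 1)" using t by (intro mult_le_mono) auto
  moreover have "1 * k \<le> (t - 2) * k" using t by (intro mult_le_mono) auto
  ultimately have k: "k < n" using n by linarith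
  have "forces_solution t m n (n - k)"
    unfolding forces_solution_def exact_coloring_def
  proof (intro allI impI)
    fix c assume "c ` {1..n} = {1..n - k}"
    then have "n \<le> card (c ` {1..n}) + k" by simp
    then show "\<exists>x. schur_solution m n x \<and> t \<le> card (c ` x ` {1..m})"
      using solution_if_many_colors[OF m t n(1)] by blast
  qed
  moreover have "n - k \<le> r" if "1 \<le> r" "forces_solution t m n r" for r
    using not_forces_solution[OF t that(1) _ n(2)] that(2) by (meson less_diff_conv not_le)
  ultimately have "RS t m n = n - k"
    unfolding RS_def using k by (intro Least_equality) auto
  then show ?thesis using k by simp
qed

theorem theorem7:
  fixes m t n :: nat
  assumes "m \<ge> 4" and "3 \<le> t" and "t \<le> m"
    and "real n \<ge> real t * (real t - 1) / 2 + real m - real t"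
  shows "int (RS t m n) =
    \<lceil>((real t - 3) * real n + real t * (real t - 1) / 2 + real m - real t) / (real t - 2)\<rceil>"
proof -
  define N where "N = t * (t - 1) div 2 + (m - t)"
  define k where "k = (n - N) div (t - 2)"
  have "real (t * (t - 1) div 2) = real t * (real t - 1) / 2"
    using assms(2) by (subst real_of_nat_div) (auto simp: of_nat_diff)
  then have N: "real N = real t * (real t - 1) / 2 + real m - real t"
    using assms(3) by (simp add: N_def of_nat_diff)
  then have Nn: "N \<le> n" using assms(4) by linarith
  have "(t - 2) * k + (n - N) mod (t - 2) = n - N" "(n - N) mod (t - 2) < t - 2"
    using assms(2) by (auto simp: k_def)
  then have k: "N + (t - 2) * k \<le> n" "n < N + (t - 2) * (k + 1)"
    using Nn unfolding distrib_left by linarith+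
  have RS: "RS t m n + k = n"
    using RS_eq[OF assms(1-3)] k unfolding N_def by blast
  have "real (N + (t - 2) * k) \<le> real n" "real n < real (N + (t - 2) * (k + 1))"
    using k by (auto simp only: of_nat_le_iff of_nat_less_iff)
  moreover have "real (t - 2) = real t - 2" using assms(2) by (simp add: of_nat_diff)
  ultimately have rk: "real N + (real t - 2) * real k \<le> real n"
    "real n < real N + (real t - 2) * (real k + 1)"
    by (simp_all only: of_nat_add of_nat_mult of_nat_1)
  have RSr: "real (RS t m n) = real n - real k" using RS by linarith
  \<comment> \<open>The quotient equals \<open>n - (n - N) / (t - 2)\<close>, and \<open>k\<close>
    is the integer part of the subtracted fraction.\<close>
  have "\<lceil>((real t - 3) * real n + real N) / (real t - 2)\<rceil> = int (RS t m n)"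
  proof (rule ceiling_unique)
    show "real_of_int (int (RS t m n)) - 1 < ((real t - 3) * real n + real N) / (real t - 2)"
      using rk assms(2) by (subst pos_less_divide_eq) (simp_all add: RSr algebra_simps)
    show "((real t - 3) * real n + real N) / (real t - 2) \<le> real_of_int (int (RS t m n))"
      using rk assms(2) by (subst pos_divide_le_eq) (simp_all add: RSr algebra_simps)
  qed
  then show ?thesis by (simp add: N algebra_simps)
qed

end
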